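(* Let $k\ge 2$ and $\ell\ge 2k-1$ be integers and set $t=\lfloor\ell/(2k-1)\rfloor$. Assume that $q>\binom{2k-1}{2}+(2k-1)\ell$ is a prime power. Then Algorithm 1 (described in the context), applied to any input vector $\underline{z}\in\mathbb{F}_q^\ell$ with pairwise distinct coordinates, outputs a set $\mathcal{A}$ of evaluation vectors such that $$\mathsf{RS}_{\ell,k}(\underline{\alpha})\cap\mathsf{RS}_{\ell,k}(\underline{\alpha}')=\langle\underline{1}\rangle_{\mathbb{F}_q}\quad\text{for all distinct }\underline{\alpha},\underline{\alpha}'\in\mathcal{A}.$$ Furthermore, $$|\mathcal{A}|\ \ge\ \left(\frac{q-\binom{2k-1}{2}-(2k-1)^2(t-1)}{\binom{k}{2}}\right)^t.$$ In other words, for fixed $k$ and $\ell$, Algorithm 1 constructs an $(\ell,k,q;1)$ Reed--Solomon sunflower with $\Omega_{\ell,k}\bigl(q^{\lfloor\ell/(2k-1)\rfloor}\bigr)$ petals.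
   Context: $\underline{1}=(1,\ldots,1)$. For $\underline{\alpha}\in\mathbb{F}_q^\ell$ with pairwise distinct entries, $\mathsf{RS}_{\ell,k}(\underline{\alpha})=\{(f(\alpha_1),\ldots,f(\alpha_\ell)) : f\in\mathbb{F}_q[x],\ \deg f<k\}$. For $1\le c<k\le\ell\le q$, an $(\ell,k,q;c)$ Reed--Solomon sunflower is a family of $k$-dimensional Reed--Solomon codes in $\mathbb{F}_q^\ell$ (its petals) for which there is a fixed $c$-dimensional subspace $E$ (the center) such that any two distinct members intersect exactly in $E$. $\Omega_{\ell,k}$ hides a positive constant depending only on $\ell,k$ (as $q\to\infty$). For $\underline{x},\underline{y}\in\mathbb{F}_q^{2k-1}$, $V_{k,2k-1}(\underline{x},\underline{y})$ is the $(2k-1)\times(2k-1)$ matrix whose $h$-th row is $(1,x_h,\ldots,x_h^{k-1},y_h,\ldots,y_h^{k-1})$. The symbol $\circ$ denotes concatenation of vectors. Algorithm 1. Input: integers $k\ge2$, $\ell\ge 2k-1$, and $\underline{z}\in\mathbb{F}_q^\ell$ with pairwise distinct entries; $t=\lfloor\ell/(2k-1)\rfloor$. Step 1. Set $\mathcal{A}_1=\{\underline{z}\}$. Repeat: let $\mathcal{B}\subseteq\mathbb{F}_q^{2k-1}$ be the set of all $\underline{x}$ such that either (i) there is $\underline{y}\in\mathcal{A}_1$ with $\det V_{k,2k-1}((y_1,\ldots,y_{2k-1}),\underline{x})=0$, or (ii) $x_i=x_j$ for some distinct $i,j\in\{1,\ldots,2k-1\}$. If $\mathcal{B}\ne\mathbb{F}_q^{2k-1}$,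 pick any $\underline{u}\in\mathbb{F}_q^{2k-1}\setminus\mathcal{B}$ and any $\underline{u}'\in\mathbb{F}_q^{\ell-(2k-1)}$ such that $\underline{u}\circ\underline{u}'$ has pairwise distinct coordinates, and add $\underline{u}\circ\underline{u}'$ to $\mathcal{A}_1$; if $\mathcal{B}=\mathbb{F}_q^{2k-1}$, exit the loop. Step 2. For each $s=2,\ldots,t$: for each $\underline{z}\in\mathcal{A}_{s-1}$, construct $\mathcal{A}_s^{(\underline{z})}$ as follows. Set $\mathcal{A}_s^{(\underline{z})}=\{\underline{z}\}$. Repeat: let $\mathcal{B}\subseteq\mathbb{F}_q^{2k-1}$ be the set of all $\underline{x}$ such that (i) there is $\underline{y}\in\mathcal{A}_s^{(\underline{z})}$ with $\det V_{k,2k-1}((y_{(s-1)(2k-1)+1},\ldots,y_{s(2k-1)}),\underline{x})=0$, or (ii) $x_i=x_j$ for some distinct $i,j$, or (iii) $\{x_1,\ldots,x_{2k-1}\}\cap\{z_1,\ldots,z_{(s-1)(2k-1)}\}\ne\emptyset$. If $\mathcal{B}\ne\mathbb{F}_q^{2k-1}$, pick any $\underline{u}\in\mathbb{F}_q^{2k-1}\setminus\mathcal{B}$ and any $\underline{u}'\in\mathbb{F}_q^{\ell-s(2k-1)}$ such that $(z_1,\ldots,z_{(s-1)(2k-1)})\circ\underline{u}\circ\underline{u}'$ has pairwise distinct coordinates, and add this vector to $\mathcal{A}_s^{(\underline{z})}$; otherwise exit the loop and go to the next $\underline{z}$. After all $\underline{z}\in\mathcal{A}_{s-1}$ are processed,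 set $\mathcal{A}_s=\bigcup_{\underline{z}\in\mathcal{A}_{s-1}}\mathcal{A}_s^{(\underline{z})}$. Step 3. Output $\mathcal{A}=\mathcal{A}_t$. *)

theory Defs
  imports
    "Jordan_Normal_Form.VS_Connect"
    "HOL-Library.Cardinality"
    "HOL-Library.While_Combinator"
    "HOL-Library.Landau_Symbols"
begin

text \<open>The field $F_q$ is a type \<open>'a :: {field, finite}\<close> with \<open>q = CARD('a)\<close>, and $F_q^n$ is
  \<^term>\<open>carrier_vec n\<close>. Coordinates are numbered from 0.\<close>

definition evaluation_vector :: "nat \<Rightarrow> 'a vec \<Rightarrow> bool" where
  "evaluation_vector l \<alpha> \<longleftrightarrow> \<alpha> \<in> carrier_vec l \<and> distinct (list_of_vec \<alpha>)"

text \<open>The library's \<^term>\<open>degree 0 = 0\<close> is harmless here, because only \<open>k \<ge> 1\<close> is used.\<close>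

definition RS :: "nat \<Rightarrow> nat \<Rightarrow> 'a::field vec \<Rightarrow> 'a vec set" where
  "RS l k \<alpha> = {vec l (\<lambda>i. poly f (\<alpha> $ i)) | f. degree f < k}"

definition lin_span :: "nat \<Rightarrow> 'a::field vec set \<Rightarrow> 'a vec set" where
  "lin_span l S = LinearCombinations.module.span class_ring (module_vec TYPE('a) l) S"

definition is_subspace :: "nat \<Rightarrow> 'a::field vec set \<Rightarrow> bool" where
  "is_subspace l E \<longleftrightarrow> VectorSpace.subspace class_ring E (module_vec TYPE('a) l)"

definition subspace_dim :: "nat \<Rightarrow> 'a::field vec set \<Rightarrow> nat" where
  "subspace_dim l E = vectorspace.dim class_ring (module_vec TYPE('a) l \<lparr>carrier := E\<rparr>)"

definition RS_sunflower :: "nat \<Rightarrow> nat \<Rightarrow> nat \<Rightarrow> 'a::{field,finite} vec set set \<Rightarrow> bool" where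
  "RS_sunflower l k c P \<longleftrightarrow>
     1 \<le> c \<and> c < k \<and> k \<le> l \<and> l \<le> CARD('a) \<and>
     (\<forall>C\<in>P. is_subspace l C \<and> subspace_dim l C = k \<and>
        (\<exists>\<alpha>. evaluation_vector l \<alpha> \<and> C = RS l k \<alpha>)) \<and>
     (\<exists>E. is_subspace l E \<and> subspace_dim l E = c \<and>
        (\<forall>C\<in>P. \<forall>D\<in>P. C \<noteq> D \<longrightarrow> C \<inter> D = E))"

text \<open>Row \<open>h\<close> is $(1, x_h, \ldots, x_h^{k-1}, y_h, \ldots, y_h^{k-1})$: column \<open>j \<ge> k\<close>
  carries the exponent \<open>j - (k - 1)\<close>.\<close>

definition V_mat :: "nat \<Rightarrow> 'a::field vec \<Rightarrow> 'a vec \<Rightarrow> 'a mat" where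
  "V_mat k x y = mat (2 * k - 1) (2 * k - 1)
     (\<lambda>(h, j). if j < k then x $ h ^ j else y $ h ^ (j + 1 - k))"

text \<open>A parameter \<open>r\<close> always counts the blocks of length \<open>2 * k - 1\<close> that are already fixed, so
  it stands for $s - 1$ in stage $s$ of the algorithm.\<close>

definition block :: "nat \<Rightarrow> nat \<Rightarrow> 'a vec \<Rightarrow> 'a vec" where
  "block k r y = vec (2 * k - 1) (\<lambda>i. y $ (r * (2 * k - 1) + i))"

definition fixed_prefix :: "nat \<Rightarrow> nat \<Rightarrow> 'a vec \<Rightarrow> 'a vec" where
  "fixed_prefix k r z = vec_first z (r * (2 * k - 1))"

text \<open>The set $B$ of the algorithm. In the first stage (\<open>r = 0\<close>) the prefix is empty, so the third
  condition is void and this is the set used in Step 1.\<close>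

definition blocked :: "nat \<Rightarrow> nat \<Rightarrow> 'a::field vec \<Rightarrow> 'a vec set \<Rightarrow> 'a vec set" where
  "blocked k r z A = {x \<in> carrier_vec (2 * k - 1).
     (\<exists>y\<in>A. det (V_mat k (block k r y) x) = 0) \<or>
     \<not> distinct (list_of_vec x) \<or>
     set\<^sub>v x \<inter> set\<^sub>v (fixed_prefix k r z) \<noteq> {}}"

definition candidates ::
    "nat \<Rightarrow> nat \<Rightarrow> nat \<Rightarrow> 'a::field vec \<Rightarrow> 'a vec set \<Rightarrow> 'a vec set" where
  "candidates k l r z A = {fixed_prefix k r z @\<^sub>v u @\<^sub>v u' | u u'.
     u \<in> carrier_vec (2 * k - 1) - blocked k r z A \<and>
     u' \<in> carrier_vec (l - Suc r * (2 * k - 1)) \<and>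
     distinct (list_of_vec (fixed_prefix k r z @\<^sub>v u @\<^sub>v u'))}"

text \<open>The choices ``pick any'' are resolved by an arbitrary selector, which sees the stage, the
  vector \<open>z\<close> being extended and the set built so far. Every run of the algorithm comes from such a
  selector: each addition enlarges the set, so no state occurs twice. In a state without
  candidates the value of the selector is unconstrained.\<close>

definition valid_selector ::
    "nat \<Rightarrow> nat \<Rightarrow> (nat \<Rightarrow> 'a::field vec \<Rightarrow> 'a vec set \<Rightarrow> 'a vec) \<Rightarrow> bool" where
  "valid_selector k l pick \<longleftrightarrow>
     (\<forall>r z A. candidates k l r z A \<noteq> {} \<longrightarrow> pick r z A \<in> candidates k l r z A)"

text \<open>The inner loop; the value is \<^term>\<open>None\<close> iff it does not terminate.\<close>

definition extend_loop ::
    "(nat \<Rightarrow> 'a::field vec \<Rightarrow> 'a vec set \<Rightarrow> 'a vec) \<Rightarrow> nat \<Rightarrow> nat \<Rightarrow> 'a vec \<Rightarrow> 'a vec set option" where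
  "extend_loop pick k r z =
     while_option (\<lambda>A. blocked k r z A \<noteq> carrier_vec (2 * k - 1))
       (\<lambda>A. insert (pick r z A) A) {z}"

text \<open>\<open>stages pick k z s\<close> is $A_s$, with $A_0 = \{z\}$; hence $A_1$ is the result of the loop started
  from the input \<open>z\<close>.\<close>

primrec stages ::
    "(nat \<Rightarrow> 'a::field vec \<Rightarrow> 'a vec set \<Rightarrow> 'a vec) \<Rightarrow> nat \<Rightarrow> 'a vec \<Rightarrow> nat \<Rightarrow> 'a vec set option" where
  "stages pick k z 0 = Some {z}"
| "stages pick k z (Suc r) =
     (case stages pick k z r of
        None \<Rightarrow> None
      | Some A \<Rightarrow>
          if \<forall>y\<in>A. extend_loop pick k r y \<noteq> None
          then Some (\<Union>y\<in>A. the (extend_loop pick k r y)) else None)"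

definition algorithm1 ::
    "(nat \<Rightarrow> 'a::field vec \<Rightarrow> 'a vec set \<Rightarrow> 'a vec) \<Rightarrow> nat \<Rightarrow> nat \<Rightarrow> 'a vec \<Rightarrow> 'a vec set option" where
  "algorithm1 pick k l z = stages pick k z (l div (2 * k - 1))"

text \<open>A function of the numbers \<open>k\<close>, \<open>l\<close> and \<open>q\<close> alone, so an asymptotic statement about it as
  \<open>q\<close> grows is uniform in the field.\<close>

definition petal_bound :: "nat \<Rightarrow> nat \<Rightarrow> nat \<Rightarrow> real" where
  "petal_bound k l q = (let t = l div (2 * k - 1) in
     ((real q - real ((2 * k - 1) choose 2) - real ((2 * k - 1)^2) * (real t - 1))
        / real (k choose 2)) ^ t)"

end

theory Submission
  imports Defs "Jordan_Normal_Form.DL_Rank"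
begin

text \<open>The determinant of \<open>V_mat k x y\<close> is zero iff there are polynomials \<open>f\<close> and \<open>g\<close> of degree below \<open>k\<close>,
  not both zero and with \<open>g\<close> vanishing at \<open>0\<close>, such that \<open>f(x\<^sub>h) + g(y\<^sub>h) = 0\<close> for all \<open>h\<close>. So if it is
  nonzero, the codes on the coordinates \<open>x\<close> and on the coordinates \<open>y\<close> share only constant words.
  A single block of coordinates with this property forces the intersection of two full-length codes
  down to the span of the all-ones vector (\<open>RS_inter\<close>).

  The algorithm builds its vectors block by block and keeps such a block between any two of them:
  vectors found in the same loop differ in this sense in the newest block, and vectors that extend
  different vectors of the previous stage inherit a separating block from these (\<open>stages_result\<close>).

  How many vectors a loop finds follows from its stopping condition: the blocked vectors fill
  the space of all \<open>q\<^bsup>2k-1\<^esup>\<close> vectors. The key count (\<open>card_vanishing_pair\<close>) is that, for \<open>x\<close> with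
  distinct entries, at most a proportion \<open>(k choose 2) / q\<close> of all \<open>y\<close> makes the determinant zero.
  It is obtained without multivariate polynomials. Keep \<open>k\<close> columns for \<open>x\<close> and \<open>m\<close> columns for \<open>y\<close>,
  and delete the last row and the last column: if the smaller system has only the trivial solution,
  the larger system without its last row has a one-dimensional solution space, and the last entry of
  \<open>y\<close> must be a root of one fixed polynomial of degree \<open>m\<close>. Summing \<open>m\<close> from \<open>1\<close> to \<open>k - 1\<close> gives
  \<open>k choose 2\<close>. Adding the other two reasons for a vector to be blocked yields a lower bound for
  the size of each loop (\<open>card_le_if_all_blocked\<close>), and the bounds of the \<open>t\<close> stages multiply.\<close>

section \<open>Counting bad vectors one coordinate at a time\<close>

text \<open>All three reasons for which a vector can be blocked are counted by appending one entry at a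
  time: a prefix that is already bad accounts for \<open>CARD('a)\<close> extensions, and a good prefix
  can be spoiled by at most \<open>d\<close> values of the new entry. This replaces the Schwartz--Zippel lemma.\<close>

lemma card_lists_snoc_le:
  fixes B C :: "'a::finite list set"
  assumes B: "\<And>xs. xs \<in> B \<Longrightarrow> length xs = n"
    and C: "\<And>ys. ys \<in> C \<Longrightarrow> length ys = Suc n"
    and step: "\<And>xs. length xs = n \<Longrightarrow> xs \<notin> B \<Longrightarrow> card {a. xs @ [a] \<in> C} \<le> d"
  shows "card C \<le> card B * CARD('a) + d * CARD('a) ^ n"
proof -
  let ?L = "{xs :: 'a list. length xs = n}"
  have finL: "finite ?L" and cL: "card ?L = CARD('a) ^ n"
    using finite_lists_length_eq[of "UNIV :: 'a set" n] card_lists_length_eq[of "UNIV :: 'a set" n]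
    by auto
  have finB: "finite B" by (rule finite_subset[OF _ finL]) (use B in auto)
  let ?S = "SIGMA xs:?L - B. {a. xs @ [a] \<in> C}"
  have "C \<subseteq> (\<lambda>(xs, a). xs @ [a]) ` (B \<times> UNIV \<union> ?S)"
  proof
    fix ys assume ys: "ys \<in> C"
    from C[OF ys] obtain xs a where "ys = xs @ [a]" "length xs = n"
      by (metis length_Suc_conv_rev)
    with ys show "ys \<in> (\<lambda>(xs, a). xs @ [a]) ` (B \<times> UNIV \<union> ?S)"
      by (cases "xs \<in> B") (auto intro!: image_eqI[of _ _ "(xs, a)"])
  qed
  then have "card C \<le> card (B \<times> (UNIV :: 'a set) \<union> ?S)"
    using finB finL by (intro surj_card_le) auto
  also have "\<dots> \<le> card B * CARD('a) + card ?S"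
    using card_Un_le[of "B \<times> (UNIV :: 'a set)" ?S] by (simp add: card_cartesian_product)
  also have "card ?S = (\<Sum>xs\<in>?L - B. card {a. xs @ [a] \<in> C})"
    using finL by (subst card_SigmaI) auto
  also have "\<dots> \<le> (\<Sum>xs\<in>?L - B. d)"
    by (rule sum_mono) (use step in auto)
  also have "\<dots> \<le> (\<Sum>xs\<in>?L. d)"
    using finL by (intro sum_mono2) auto
  also have "\<dots> = d * CARD('a) ^ n"
    using cL by simp
  finally show ?thesis by simp
qed

lemma choose_two_Suc: "Suc n choose 2 = (n choose 2) + n"
  by (simp add: numeral_2_eq_2)

text \<open>A distinct list of length \<open>n\<close> loses distinctness for at most \<open>n\<close> values of the next entry, so the
  bad values add up to \<open>0 + 1 + \<dots> + (n - 1)\<close>. Here and below, both sides carry an extra factor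
  \<open>CARD('a)\<close> in place of the exponent \<open>n - 1\<close>, whose truncated subtraction would spoil \<open>n = 0\<close>.\<close>

lemma card_not_distinct_lists:
  "card {xs :: 'a::finite list. length xs = n \<and> \<not> distinct xs} * CARD('a) \<le> (n choose 2) * CARD('a) ^ n"
proof (induction n)
  case 0
  have empty: "{xs :: 'a list. length xs = 0 \<and> \<not> distinct xs} = {}" by auto
  show ?case unfolding empty by simp
next
  case (Suc n)
  let ?B = "{xs :: 'a list. length xs = n \<and> \<not> distinct xs}"
  let ?C = "{xs :: 'a list. length xs = Suc n \<and> \<not> distinct xs}"
  have "card ?C \<le> card ?B * CARD('a) + n * CARD('a) ^ n"
  proof (rule card_lists_snoc_le)
    fix xs :: "'a list" assume "length xs = n" "xs \<notin> ?B"
    then have "{a. xs @ [a] \<in> ?C} \<subseteq> set xs" by auto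
    then have "card {a. xs @ [a] \<in> ?C} \<le> card (set xs)" by (intro card_mono) auto
    also have "\<dots> \<le> n" using card_length[of xs] \<open>length xs = n\<close> by simp
    finally show "card {a. xs @ [a] \<in> ?C} \<le> n" .
  qed auto
  also have "\<dots> \<le> (n choose 2) * CARD('a) ^ n + n * CARD('a) ^ n" using Suc by simp
  also have "\<dots> = (Suc n choose 2) * CARD('a) ^ n" by (simp add: choose_two_Suc algebra_simps)
  finally have "card ?C * CARD('a) \<le> (Suc n choose 2) * CARD('a) ^ n * CARD('a)"
    by (rule mult_right_mono) simp
  then show ?case by (simp add: algebra_simps)
qed

lemma card_lists_meeting:
  "card {xs :: 'a::finite list. length xs = n \<and> set xs \<inter> S \<noteq> {}} * CARD('a) \<le> n * card S * CARD('a) ^ n"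
proof (induction n)
  case 0
  have empty: "{xs :: 'a list. length xs = 0 \<and> set xs \<inter> S \<noteq> {}} = {}" by auto
  show ?case unfolding empty by simp
next
  case (Suc n)
  let ?B = "{xs :: 'a list. length xs = n \<and> set xs \<inter> S \<noteq> {}}"
  let ?C = "{xs :: 'a list. length xs = Suc n \<and> set xs \<inter> S \<noteq> {}}"
  have "card ?C \<le> card ?B * CARD('a) + card S * CARD('a) ^ n"
  proof (rule card_lists_snoc_le)
    fix xs :: "'a list" assume "length xs = n" "xs \<notin> ?B"
    then have "{a. xs @ [a] \<in> ?C} \<subseteq> S" by auto
    then show "card {a. xs @ [a] \<in> ?C} \<le> card S" by (intro card_mono) auto
  qed auto
  also have "\<dots> \<le> n * card S * CARD('a) ^ n + card S * CARD('a) ^ n" using Suc by simp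
  also have "\<dots> = Suc n * card S * CARD('a) ^ n" by (simp add: algebra_simps)
  finally have "card ?C * CARD('a) \<le> Suc n * card S * CARD('a) ^ n * CARD('a)"
    by (rule mult_right_mono) simp
  then show ?case by (simp add: algebra_simps)
qed

section \<open>Vanishing pairs of polynomials\<close>

text \<open>The two polynomials are the two halves of a kernel vector of the matrix with rows
  \<open>(1, y\<^sub>h, \<dots>, y\<^sub>h\<^bsup>k-1\<^esup>, x\<^sub>h, \<dots>, x\<^sub>h\<^sup>m)\<close>. The number \<open>m\<close> of columns in \<open>x\<close> is a parameter of its own,
  because dropping the last row together with the last column is what drives the count.\<close>

definition vanishing_pair :: "nat \<Rightarrow> nat \<Rightarrow> (nat \<Rightarrow> 'a::field) \<Rightarrow> 'a list \<Rightarrow> bool" where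
  "vanishing_pair k m y xs \<longleftrightarrow> (\<exists>f g. (f \<noteq> 0 \<or> g \<noteq> 0) \<and> degree f < k \<and> degree g \<le> m \<and> coeff g 0 = 0 \<and>
     (\<forall>h<k + m. poly f (y h) + poly g (xs ! h) = 0))"

text \<open>Independence of the first \<open>k + m\<close> rows with \<open>m\<close> powers of \<open>x\<close> forces any vanishing pair on them with
  \<open>Suc m\<close> powers to have a nonzero top coefficient in \<open>g\<close>. Two such pairs are therefore proportional:
  the combination that cancels the top coefficients is a pair for \<open>m\<close>. Hence the last row is the
  same condition for every possible last entry, namely that it be a root of one fixed polynomial of
  degree \<open>Suc m\<close>.\<close>

lemma card_last_entry_vanishing_pair:
  fixes y :: "nat \<Rightarrow> 'a::{field,finite}"
  assumes len: "length xs = k + m" and indep: "\<not> vanishing_pair k m y xs"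
  shows "card {a. vanishing_pair k (Suc m) y (xs @ [a])} \<le> Suc m"
proof (cases "{a. vanishing_pair k (Suc m) y (xs @ [a])} = {}")
  case True
  then show ?thesis by simp
next
  case False
  let ?e = "y (k + m)"
  have unpack: "\<exists>f g. degree f < k \<and> degree g \<le> Suc m \<and> coeff g 0 = 0 \<and> coeff g (Suc m) \<noteq> 0 \<and>
      (\<forall>h<k + m. poly f (y h) + poly g (xs ! h) = 0) \<and> poly f ?e + poly g a = 0"
    if "vanishing_pair k (Suc m) y (xs @ [a])" for a
  proof -
    from that obtain f g where fg: "f \<noteq> 0 \<or> g \<noteq> 0" "degree f < k" "degree g \<le> Suc m" "coeff g 0 = 0"
      "\<And>h. h < k + Suc m \<Longrightarrow> poly f (y h) + poly g ((xs @ [a]) ! h) = 0"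
      unfolding vanishing_pair_def by blast
    have rows: "poly f (y h) + poly g (xs ! h) = 0" if "h < k + m" for h
      using fg(5)[of h] that len by (simp add: nth_append)
    have last: "poly f ?e + poly g a = 0"
      using fg(5)[of "k + m"] len by (simp add: nth_append)
    have "coeff g (Suc m) \<noteq> 0"
    proof
      assume "coeff g (Suc m) = 0"
      then have "degree g \<le> m"
        using fg(3) by (metis le_SucE leading_coeff_0_iff degree_0 le0)
      then show False
        using indep fg rows unfolding vanishing_pair_def by blast
    qed
    then show ?thesis using fg rows last by blast
  qed
  from False obtain a0 where "vanishing_pair k (Suc m) y (xs @ [a0])" by blast
  from unpack[OF this] obtain f0 g0 where p0: "degree f0 < k" "degree g0 \<le> Suc m" "coeff g0 0 = 0"
      "coeff g0 (Suc m) \<noteq> 0" "\<And>h. h < k + m \<Longrightarrow> poly f0 (y h) + poly g0 (xs ! h) = 0" by blast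
  let ?p = "g0 + [:poly f0 ?e:]"
  have sub: "{a. vanishing_pair k (Suc m) y (xs @ [a])} \<subseteq> {a. poly ?p a = 0}"
  proof
    fix a assume "a \<in> {a. vanishing_pair k (Suc m) y (xs @ [a])}"
    then have "vanishing_pair k (Suc m) y (xs @ [a])" by simp
    from unpack[OF this] obtain f g where p: "degree f < k" "degree g \<le> Suc m" "coeff g 0 = 0"
      "coeff g (Suc m) \<noteq> 0" "\<And>h. h < k + m \<Longrightarrow> poly f (y h) + poly g (xs ! h) = 0"
      "poly f ?e + poly g a = 0" by blast
    let ?c = "coeff g0 (Suc m)" and ?d = "coeff g (Suc m)"
    \<comment> \<open>the combination of the two pairs in which the terms of degree \<open>Suc m\<close> of \<open>g\<close> cancel\<close>
    let ?F = "Polynomial.smult ?c f - Polynomial.smult ?d f0"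
    let ?G = "Polynomial.smult ?c g - Polynomial.smult ?d g0"
    have dF: "degree ?F < k"
      by (intro degree_diff_less le_less_trans[OF degree_smult_le]) (use p p0 in auto)
    have "degree ?G \<le> Suc m"
      by (intro degree_diff_le order_trans[OF degree_smult_le]) (use p p0 in auto)
    moreover have "coeff ?G (Suc m) = 0" by simp
    ultimately have dG: "degree ?G \<le> m"
      by (metis le_SucE leading_coeff_0_iff degree_0 le0)
    have rows: "poly ?F (y h) + poly ?G (xs ! h) = 0" if "h < k + m" for h
    proof -
      have "poly ?F (y h) + poly ?G (xs ! h) =
        ?c * (poly f (y h) + poly g (xs ! h)) - ?d * (poly f0 (y h) + poly g0 (xs ! h))"
        by (simp add: algebra_simps)
      then show ?thesis using p(5)[OF that] p0(5)[OF that] by simp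
    qed
    have c0: "coeff ?G 0 = 0" using p p0 by simp
    have "?F = 0 \<and> ?G = 0"
      using indep dF dG c0 rows unfolding vanishing_pair_def by blast
    then have "poly ?F ?e + poly ?G a = 0" by (metis add_0 poly_0)
    then have "?c * (poly f ?e + poly g a) = ?d * (poly f0 ?e + poly g0 a)"
      by (simp add: algebra_simps)
    then have "poly f0 ?e + poly g0 a = 0" using p by simp
    then show "a \<in> {a. poly ?p a = 0}" by (simp add: add.commute)
  qed
  have cp: "coeff ?p (Suc m) \<noteq> 0" using p0 by simp
  then have "?p \<noteq> 0" by (metis coeff_0)
  then have "card {a. poly ?p a = 0} \<le> degree ?p" by (rule card_poly_roots_bound)
  also have "degree ?p \<le> Suc m" by (intro degree_add_le) (use p0 in auto)
  finally show ?thesis using card_mono[OF _ sub] by simp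
qed

text \<open>The proportion of bad vectors is at most \<open>(1 + 2 + \<dots> + m) / q\<close>: the sum is the degree of the
  determinant as a polynomial in the entries of \<open>x\<close>. For \<open>m = 0\<close> a vanishing pair would be a nonzero
  polynomial of degree below \<open>k\<close> with \<open>k\<close> distinct roots.\<close>

lemma card_vanishing_pair:
  fixes y :: "nat \<Rightarrow> 'a::{field,finite}"
  assumes "inj_on y {..<k + m}"
  shows "card {xs. length xs = k + m \<and> vanishing_pair k m y xs} * CARD('a)
     \<le> (Suc m choose 2) * CARD('a) ^ (k + m)"
  using assms
proof (induction m)
  case 0
  have "\<not> vanishing_pair k 0 y xs" for xs
  proof
    assume "vanishing_pair k 0 y xs"
    then obtain f g where fg: "f \<noteq> 0 \<or> g \<noteq> 0" "degree f < k" "degree g = 0" "coeff g 0 = 0"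
      "\<And>h. h < k \<Longrightarrow> poly f (y h) + poly g (xs ! h) = 0"
      unfolding vanishing_pair_def by auto
    then have "g = 0" by (metis leading_coeff_0_iff)
    then have "f \<noteq> 0" "y ` {..<k} \<subseteq> {x. poly f x = 0}" using fg by auto
    then have "card (y ` {..<k}) \<le> degree f"
      using card_poly_roots_bound[of f] poly_roots_finite[of f] card_mono order_trans by blast
    then show False using 0 fg(2) by (simp add: card_image)
  qed
  then show ?case by simp
next
  case (Suc m)
  let ?B = "{xs. length xs = k + m \<and> vanishing_pair k m y xs}"
  let ?C = "{xs. length xs = k + Suc m \<and> vanishing_pair k (Suc m) y xs}"
  have IH: "card ?B * CARD('a) \<le> (Suc m choose 2) * CARD('a) ^ (k + m)"
    using Suc.prems by (intro Suc.IH) (auto elim: inj_on_subset)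
  have "card ?C \<le> card ?B * CARD('a) + Suc m * CARD('a) ^ (k + m)"
  proof (rule card_lists_snoc_le)
    fix xs assume "length xs = k + m" "xs \<notin> ?B"
    then show "card {a. xs @ [a] \<in> ?C} \<le> Suc m"
      using card_last_entry_vanishing_pair[of xs k m y] by simp
  qed auto
  also have "\<dots> \<le> (Suc m choose 2) * CARD('a) ^ (k + m) + Suc m * CARD('a) ^ (k + m)" using IH by simp
  also have "\<dots> = (Suc (Suc m) choose 2) * CARD('a) ^ (k + m)"
    by (subst choose_two_Suc[of "Suc m"]) (simp add: algebra_simps)
  finally have "card ?C * CARD('a) \<le> (Suc (Suc m) choose 2) * CARD('a) ^ (k + m) * CARD('a)"
    by (rule mult_right_mono) simp
  then show ?case by (simp add: algebra_simps)
qed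

lemma poly_eq_sum_below:
  fixes p :: "'a::comm_semiring_1 poly"
  assumes "degree p < n"
  shows "poly p x = (\<Sum>i<n. coeff p i * x ^ i)"
proof -
  have "(\<Sum>i<n. coeff p i * x ^ i) = (\<Sum>i\<le>degree p. coeff p i * x ^ i)"
    by (rule sum.mono_neutral_right) (use assms in \<open>auto simp: coeff_eq_0\<close>)
  then show ?thesis by (simp add: poly_altdef)
qed

section \<open>Kernel vectors of the matrix\<close>

text \<open>Column \<open>k + i\<close> holds the power \<open>Suc i\<close> of \<open>y\<close>, which explains the shift between \<open>v\<close> and the
  coefficients of \<open>g\<close>.\<close>

lemma V_mat_row:
  assumes k: "1 \<le> k" and h: "h < 2 * k - 1" and v: "v \<in> carrier_vec (2 * k - 1)"
    and f: "degree f < k" "\<And>j. j < k \<Longrightarrow> coeff f j = v $ j"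
    and g: "degree g < k" "coeff g 0 = 0" "\<And>i. i < k - 1 \<Longrightarrow> coeff g (Suc i) = v $ (k + i)"
  shows "(V_mat k x y *\<^sub>v v) $ h = poly f (x $ h) + poly g (y $ h)"
proof -
  have split: "{0..<2 * k - 1} = {..<k} \<union> {k..<2 * k - 1}" using k by auto
  have "(V_mat k x y *\<^sub>v v) $ h
      = (\<Sum>j\<in>{0..<2 * k - 1}. (if j < k then x $ h ^ j else y $ h ^ (j + 1 - k)) * v $ j)"
    using h v by (simp add: V_mat_def scalar_prod_def)
  also have "\<dots> = (\<Sum>j<k. x $ h ^ j * v $ j) + (\<Sum>j=k..<2 * k - 1. y $ h ^ (j + 1 - k) * v $ j)"
    unfolding split by (subst sum.union_disjoint) auto
  also have "(\<Sum>j<k. x $ h ^ j * v $ j) = poly f (x $ h)"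
    using f by (simp add: poly_eq_sum_below mult.commute)
  also have "(\<Sum>j=k..<2 * k - 1. y $ h ^ (j + 1 - k) * v $ j)
      = (\<Sum>i<k - 1. y $ h ^ Suc i * v $ (k + i))"
    by (rule sum.reindex_bij_witness[of _ "\<lambda>i. k + i" "\<lambda>j. j - k"]) (use k in \<open>auto simp: Suc_diff_le\<close>)
  also have "\<dots> = (\<Sum>i<k. coeff g i * y $ h ^ i)"
  proof -
    obtain k' where "k = Suc k'" using k by (cases k) auto
    then show ?thesis using g(2,3) by (simp add: sum.lessThan_Suc_shift mult.commute del: sum.lessThan_Suc)
  qed
  also have "\<dots> = poly g (y $ h)" using g by (simp add: poly_eq_sum_below)
  finally show ?thesis .
qed

text \<open>Splitting a kernel vector into its first \<open>k\<close> and its last \<open>k - 1\<close> entries gives the coefficients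
  of \<open>f\<close> and of \<open>g\<close>; the missing constant column for \<open>y\<close> is the condition that \<open>g\<close> vanishes at \<open>0\<close>.\<close>

lemma det_V_mat_eq_0_iff:
  assumes k: "1 \<le> k" and y: "y \<in> carrier_vec (2 * k - 1)"
  shows "det (V_mat k x y) = 0 \<longleftrightarrow> vanishing_pair k (k - 1) (\<lambda>h. x $ h) (list_of_vec y)"
proof -
  let ?n = "2 * k - 1"
  have n: "k + (k - 1) = ?n" using k by simp
  have V: "V_mat k x y \<in> carrier_mat ?n ?n" by (simp add: V_mat_def)
  show ?thesis unfolding det_0_iff_vec_prod_zero[OF V]
  proof
    assume "\<exists>v. v \<in> carrier_vec ?n \<and> v \<noteq> 0\<^sub>v ?n \<and> V_mat k x y *\<^sub>v v = 0\<^sub>v ?n"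
    then obtain v where v: "v \<in> carrier_vec ?n" "v \<noteq> 0\<^sub>v ?n" "V_mat k x y *\<^sub>v v = 0\<^sub>v ?n" by blast
    define f where "f = (\<Sum>j<k. monom (v $ j) j)"
    define g where "g = (\<Sum>i<k - 1. monom (v $ (k + i)) (Suc i))"
    have cf: "coeff f j = (if j < k then v $ j else 0)" for j
      by (simp add: f_def coeff_sum)
    have cg: "coeff g (Suc i) = (if i < k - 1 then v $ (k + i) else 0)" for i
      by (simp add: g_def coeff_sum)
    have cg0: "coeff g 0 = 0" by (simp add: g_def coeff_sum)
    have df: "degree f < k" using k by (intro degree_lessI) (auto simp: cf)
    have dg: "degree g < k"
    proof (rule degree_lessI)
      show "\<forall>i\<ge>k. coeff g i = 0"
      proof (intro allI impI)
        fix i assume "k \<le> i" then show "coeff g i = 0" using k by (cases i) (auto simp: cg)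
      qed
    qed (use k in auto)
    have rows: "poly f (x $ h) + poly g (y $ h) = 0" if "h < ?n" for h
      using V_mat_row[OF k that v(1) df _ dg cg0, of x y] that v(3) by (simp add: cf cg)
    have "f \<noteq> 0 \<or> g \<noteq> 0"
    proof (rule ccontr)
      assume "\<not> ?thesis"
      then have fg: "f = 0" "g = 0" by auto
      have "v $ j = 0" if "j < ?n" for j
      proof (cases "j < k")
        case True
        then show ?thesis using cf[of j] fg by simp
      next
        case False
        then have "j - k < k - 1" "k + (j - k) = j" using that by auto
        then show ?thesis using cg[of "j - k"] fg by simp
      qed
      then have "v = 0\<^sub>v ?n" using v(1) by (intro eq_vecI) auto
      with v(2) show False by simp
    qed
    then show "vanishing_pair k (k - 1) (\<lambda>h. x $ h) (list_of_vec y)"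
      unfolding vanishing_pair_def n using df dg cg0 rows
      by (intro exI[of _ f] exI[of _ g]) (auto simp: list_of_vec_index)
  next
    assume "vanishing_pair k (k - 1) (\<lambda>h. x $ h) (list_of_vec y)"
    then obtain f g where fg: "f \<noteq> 0 \<or> g \<noteq> 0" "degree f < k" "degree g \<le> k - 1" "coeff g 0 = 0"
      "\<And>h. h < ?n \<Longrightarrow> poly f (x $ h) + poly g (y $ h) = 0"
      unfolding vanishing_pair_def n by (auto simp: list_of_vec_index)
    have dg: "degree g < k" using fg(3) k by simp
    define v where "v = vec ?n (\<lambda>j. if j < k then coeff f j else coeff g (Suc (j - k)))"
    have v: "v \<in> carrier_vec ?n" by (simp add: v_def)
    have cf: "coeff f j = v $ j" if "j < k" for j using that by (simp add: v_def)
    have cg: "coeff g (Suc i) = v $ (k + i)" if "i < k - 1" for i using that by (simp add: v_def)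
    have "V_mat k x y *\<^sub>v v = 0\<^sub>v ?n"
    proof (rule eq_vecI)
      fix h assume "h < dim_vec (0\<^sub>v ?n :: 'a vec)"
      then have h: "h < ?n" by simp
      from V_mat_row[OF k h v fg(2) cf dg fg(4) cg, of x y] fg(5)[OF h] h
      show "(V_mat k x y *\<^sub>v v) $ h = 0\<^sub>v ?n $ h" by simp
    qed (simp add: V_mat_def)
    moreover have "v \<noteq> 0\<^sub>v ?n"
    proof
      assume v0: "v = 0\<^sub>v ?n"
      have "coeff f j = 0" for j
        using cf[of j] v0 fg(2) by (cases "j < k") (auto simp: coeff_eq_0)
      moreover have "coeff g j = 0" for j
      proof (cases j)
        case 0
        then show ?thesis using fg(4) by simp
      next
        case (Suc i)
        then show ?thesis using cg[of i] v0 dg by (cases "i < k - 1") (auto simp: coeff_eq_0)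
      qed
      ultimately show False using fg(1) by (simp add: poly_eq_iff)
    qed
    ultimately show "\<exists>v. v \<in> carrier_vec ?n \<and> v \<noteq> 0\<^sub>v ?n \<and> V_mat k x y *\<^sub>v v = 0\<^sub>v ?n"
      using v by blast
  qed
qed

section \<open>Intersections of Reed--Solomon codes\<close>

text \<open>What a nonzero determinant of \<open>V_mat k x y\<close> gives, in a form symmetric in \<open>x\<close> and \<open>y\<close>: the
  codes on these coordinates share only the constant words. Unlike the determinant condition, it needs no argument
  about the order in which the two vectors were chosen.\<close>

definition agree_only_in_constants :: "nat \<Rightarrow> 'a::field vec \<Rightarrow> 'a vec \<Rightarrow> bool" where
  "agree_only_in_constants k x y \<longleftrightarrow>
     (\<forall>f g. degree f < k \<longrightarrow> degree g < k \<longrightarrow> (\<forall>h<2 * k - 1. poly f (x $ h) = poly g (y $ h))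
        \<longrightarrow> (\<exists>c. f = [:c:] \<and> g = [:c:]))"

lemma agree_only_in_constants_sym:
  "agree_only_in_constants k x y \<Longrightarrow> agree_only_in_constants k y x"
  unfolding agree_only_in_constants_def
proof (intro allI impI, goal_cases)
  case (1 f g)
  then have "\<exists>c. g = [:c:] \<and> f = [:c:]" by (metis (no_types))
  then show ?case by blast
qed

text \<open>This is what makes the members found by the algorithm distinct: the identity polynomial is not
  constant.\<close>

lemma not_agree_only_in_constants_self:
  assumes "2 \<le> k" shows "\<not> agree_only_in_constants k x x"
proof
  assume "agree_only_in_constants k x x"
  moreover have "degree [:0, 1::'a:] < k" using assms by simp
  ultimately obtain c where "[:0, 1::'a:] = [:c:]"
    unfolding agree_only_in_constants_def by blast
  then show False by simp
qed

text \<open>If \<open>f\<close> on \<open>x\<close> and \<open>g\<close> on \<open>y\<close> coincide, then moving the constant term of \<open>g\<close> to the side of \<open>f\<close>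
  gives a pair that vanishes on all rows, and nonsingularity makes both of its members zero.\<close>

lemma agree_only_in_constants_if_det:
  assumes k: "1 \<le> k" and y: "y \<in> carrier_vec (2 * k - 1)" and det: "det (V_mat k x y) \<noteq> 0"
  shows "agree_only_in_constants k x y"
  unfolding agree_only_in_constants_def
proof (intro allI impI)
  fix f g assume f: "degree f < k" and g: "degree g < k"
    and eq: "\<forall>h<2 * k - 1. poly f (x $ h) = poly g (y $ h)"
  let ?c = "[:coeff g 0:]"
  have no: "\<not> vanishing_pair k (k - 1) (\<lambda>h. x $ h) (list_of_vec y)"
    using det det_V_mat_eq_0_iff[OF k y] by blast
  have "degree (f - ?c) < k" by (intro degree_diff_less) (use f k in auto)
  moreover have "degree (?c - g) \<le> k - 1" by (intro degree_diff_le) (use g in auto)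
  moreover have "coeff (?c - g) 0 = 0" by simp
  moreover have "poly (f - ?c) (x $ h) + poly (?c - g) (list_of_vec y ! h) = 0" if "h < k + (k - 1)" for h
    using eq that k by (simp add: list_of_vec_index)
  ultimately have "f - ?c = 0 \<and> ?c - g = 0"
    using no unfolding vanishing_pair_def by blast
  then show "\<exists>c. f = [:c:] \<and> g = [:c:]" by (intro exI[of _ "coeff g 0"]) auto
qed

text \<open>One good block of coordinates decides the whole intersection: on it the polynomials behind a
  common codeword are already forced to be the same constant.\<close>

lemma RS_inter:
  assumes "agree_only_in_constants k (block k r \<alpha>) (block k r \<alpha>')"
    and r: "Suc r * (2 * k - 1) \<le> l" and k: "1 \<le> k"
  shows "RS l k \<alpha> \<inter> RS l k \<alpha>' = {vec l (\<lambda>_. c) | c. True}"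
proof
  show "RS l k \<alpha> \<inter> RS l k \<alpha>' \<subseteq> {vec l (\<lambda>_. c) | c. True}"
  proof
    fix w assume "w \<in> RS l k \<alpha> \<inter> RS l k \<alpha>'"
    then obtain f g where f: "degree f < k" "w = vec l (\<lambda>i. poly f (\<alpha> $ i))"
      and g: "degree g < k" "w = vec l (\<lambda>i. poly g (\<alpha>' $ i))" unfolding RS_def by auto
    have "poly f (block k r \<alpha> $ h) = poly g (block k r \<alpha>' $ h)" if h: "h < 2 * k - 1" for h
    proof -
      have "r * (2 * k - 1) + h < l" using h r by simp
      then have "w $ (r * (2 * k - 1) + h) = poly f (\<alpha> $ (r * (2 * k - 1) + h))"
        and "w $ (r * (2 * k - 1) + h) = poly g (\<alpha>' $ (r * (2 * k - 1) + h))"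
        using f(2) g(2) by (metis index_vec)+
      then show ?thesis using h by (simp add: block_def)
    qed
    then obtain c where "f = [:c:]" using assms(1) f(1) g(1) unfolding agree_only_in_constants_def by blast
    then show "w \<in> {vec l (\<lambda>_. c) | c. True}" using f(2) by auto
  qed
  have "vec l (\<lambda>_. c) \<in> RS l k \<beta>" for c and \<beta> :: "'a vec"
    unfolding RS_def using k by (intro CollectI exI[of _ "[:c:]"]) auto
  then show "{vec l (\<lambda>_. c) | c. True} \<subseteq> RS l k \<alpha> \<inter> RS l k \<alpha>'" by auto
qed

text \<open>The span of a finite family that is linearly independent as an indexed family, in coordinates.
  The library's sums run over sets of vectors; sums over the index set are what the Reed--Solomon
  code needs, whose basis is indexed by the exponents.\<close>

context vec_space begin

lemma subspace_dim_span_indexed: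
  assumes I: "finite I" and b: "b ` I \<subseteq> carrier_vec n"
    and indep: "\<And>c. (\<forall>i<n. (\<Sum>j\<in>I. c j * b j $ i) = 0) \<Longrightarrow> \<forall>j\<in>I. c j = 0"
  shows "span (b ` I) = {vec n (\<lambda>i. \<Sum>j\<in>I. c j * b j $ i) | c. True}" (is ?span)
    and "vectorspace.dim class_ring (vs (span (b ` I))) = card I" (is ?dim)
proof -
  have inj: "inj_on b I"
  proof (rule inj_onI, rule ccontr)
    fix i j assume ij: "i \<in> I" "j \<in> I" "b i = b j" "i \<noteq> j"
    \<comment> \<open>a repeated member would give the nontrivial relation \<open>b i - b j = 0\<close>\<close>
    let ?c = "\<lambda>h. (if h = i then 1 else 0) - (if h = j then 1 else 0) :: 'a"
    have "(\<Sum>h\<in>I. ?c h * b h $ m) = 0" for m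
      using I ij by (simp add: left_diff_distrib sum_subtractf if_distrib[of "\<lambda>t. t * _"] sum.delta cong: if_cong)
    then have "\<forall>h\<in>I. ?c h = 0" using indep[of ?c] by blast
    with ij show False by auto
  qed
  have fin: "finite (b ` I)" using I by simp
  have sum: "lincomb a (b ` I) = vec n (\<lambda>i. \<Sum>j\<in>I. a (b j) * b j $ i)" for a
  proof (rule eq_vecI)
    fix i assume "i < dim_vec (vec n (\<lambda>i. \<Sum>j\<in>I. a (b j) * b j $ i))"
    then show "lincomb a (b ` I) $ i = vec n (\<lambda>i. \<Sum>j\<in>I. a (b j) * b j $ i) $ i"
      using lincomb_index[OF _ b, of i a] by (simp add: sum.reindex[OF inj])
  qed (use lincomb_dim[OF fin b] in simp)
  show ?span
  proof
    show "span (b ` I) \<subseteq> {vec n (\<lambda>i. \<Sum>j\<in>I. c j * b j $ i) | c. True}"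
      using finite_span[OF fin b] sum by fastforce
    show "{vec n (\<lambda>i. \<Sum>j\<in>I. c j * b j $ i) | c. True} \<subseteq> span (b ` I)"
    proof
      fix w assume "w \<in> {vec n (\<lambda>i. \<Sum>j\<in>I. c j * b j $ i) | c. True}"
      then obtain c where w: "w = vec n (\<lambda>i. \<Sum>j\<in>I. c j * b j $ i)" by blast
      have "w = lincomb (\<lambda>v. c (the_inv_into I b v)) (b ` I)"
        unfolding w sum by (rule eq_vecI) (auto simp: the_inv_into_f_f[OF inj] intro!: sum.cong)
      then show "w \<in> span (b ` I)" using finite_span[OF fin b] by auto
    qed
  qed
  have "lin_indpt (b ` I)"
  proof (rule finite_lin_indpt2[OF fin b])
    fix a assume "lincomb a (b ` I) = 0\<^sub>v n"
    then have v: "vec n (\<lambda>i. \<Sum>j\<in>I. a (b j) * b j $ i) = 0\<^sub>v n" using sum by simp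
    have "(\<Sum>j\<in>I. a (b j) * b j $ i) = 0" if "i < n" for i
      using arg_cong[OF v, of "\<lambda>u. u $ i"] that by simp
    then show "\<forall>v\<in>b ` I. a v = 0" using indep[of "\<lambda>j. a (b j)"] by blast
  qed
  then have "maximal (b ` I) (\<lambda>T. T \<subseteq> b ` I \<and> lin_indpt T)"
    unfolding maximal_def by blast
  from dim_span[OF b fin this] show ?dim by (simp add: card_image[OF inj])
qed

end

lemma evaluation_vector_inj_on:
  assumes "evaluation_vector l \<alpha>"
  shows "inj_on (\<lambda>i. \<alpha> $ i) {..<l}"
proof (rule inj_onI)
  fix i j assume "i \<in> {..<l}" "j \<in> {..<l}" "\<alpha> $ i = \<alpha> $ j"
  then show "i = j"
    using assms nth_eq_iff_index_eq[of "list_of_vec \<alpha>" i j]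
    unfolding evaluation_vector_def by (auto simp: list_of_vec_index)
qed

text \<open>The evaluations of the monomials of degree below \<open>k\<close> are a basis: a relation between them is a
  polynomial of degree below \<open>k\<close> with \<open>l \<ge> k\<close> distinct roots.\<close>

lemma RS_subspace_dim:
  assumes \<alpha>: "evaluation_vector l \<alpha>" and k: "1 \<le> k" "k \<le> l"
  shows "is_subspace l (RS l k \<alpha>)" and "subspace_dim l (RS l k \<alpha>) = k"
proof -
  interpret vec_space "TYPE('a)" l .
  let ?b = "\<lambda>j. vec l (\<lambda>i. \<alpha> $ i ^ j)"
  have b: "?b ` {..<k} \<subseteq> carrier_vec l" by auto
  have indep: "\<forall>j\<in>{..<k}. c j = 0" if c: "\<forall>i<l. (\<Sum>j<k. c j * ?b j $ i) = 0" for c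
  proof -
    define p where "p = (\<Sum>j<k. monom (c j) j)"
    have cp: "coeff p j = (if j < k then c j else 0)" for j by (simp add: p_def coeff_sum)
    have dp: "degree p < k" using k by (intro degree_lessI) (auto simp: cp)
    have "poly p (\<alpha> $ i) = 0" if "i < l" for i
      using c that by (simp add: p_def poly_sum poly_monom)
    then have sub: "(\<lambda>i. \<alpha> $ i) ` {..<l} \<subseteq> {x. poly p x = 0}" by auto
    have "p = 0"
    proof (rule ccontr)
      assume "p \<noteq> 0"
      have "l = card ((\<lambda>i. \<alpha> $ i) ` {..<l})"
        using evaluation_vector_inj_on[OF \<alpha>] by (simp add: card_image)
      also have "\<dots> \<le> card {x. poly p x = 0}"
        using sub poly_roots_finite[OF \<open>p \<noteq> 0\<close>] by (rule card_mono[rotated])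
      also have "\<dots> \<le> degree p" using \<open>p \<noteq> 0\<close> by (rule card_poly_roots_bound)
      finally show False using dp k by simp
    qed
    then show ?thesis using cp by (metis coeff_0 lessThan_iff)
  qed
  have "RS l k \<alpha> = {vec l (\<lambda>i. \<Sum>j<k. c j * ?b j $ i) | c. True}"
  proof
    show "RS l k \<alpha> \<subseteq> {vec l (\<lambda>i. \<Sum>j<k. c j * ?b j $ i) | c. True}"
    proof
      fix w assume "w \<in> RS l k \<alpha>"
      then obtain f where "degree f < k" "w = vec l (\<lambda>i. poly f (\<alpha> $ i))" unfolding RS_def by auto
      then have "w = vec l (\<lambda>i. \<Sum>j<k. coeff f j * ?b j $ i)"
        by (intro eq_vecI) (auto simp: poly_eq_sum_below)
      then show "w \<in> {vec l (\<lambda>i. \<Sum>j<k. c j * ?b j $ i) | c. True}" by blast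
    qed
    show "{vec l (\<lambda>i. \<Sum>j<k. c j * ?b j $ i) | c. True} \<subseteq> RS l k \<alpha>"
    proof
      fix w assume "w \<in> {vec l (\<lambda>i. \<Sum>j<k. c j * ?b j $ i) | c. True}"
      then obtain c where w: "w = vec l (\<lambda>i. \<Sum>j<k. c j * ?b j $ i)" by blast
      define p where "p = (\<Sum>j<k. monom (c j) j)"
      have "degree p < k" using k by (intro degree_lessI) (auto simp: p_def coeff_sum)
      moreover have "w = vec l (\<lambda>i. poly p (\<alpha> $ i))"
        unfolding w by (intro eq_vecI) (auto simp: p_def poly_sum poly_monom)
      ultimately show "w \<in> RS l k \<alpha>" unfolding RS_def by blast
    qed
  qed
  then have RS: "RS l k \<alpha> = span (?b ` {..<k})"
    using subspace_dim_span_indexed(1)[OF _ b indep] by simp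
  show "is_subspace l (RS l k \<alpha>)"
    unfolding is_subspace_def RS by (rule span_is_subspace) (use b in simp)
  show "subspace_dim l (RS l k \<alpha>) = k"
    unfolding subspace_dim_def RS using subspace_dim_span_indexed(2)[OF _ b indep] by simp
qed

text \<open>The center of the sunflower is itself a Reed--Solomon code, so its dimension needs no separate
  computation.\<close>

lemma RS_dimension_one: "RS l 1 \<alpha> = {vec l (\<lambda>_. c) | c. True}"
proof -
  have "RS l 1 \<alpha> = {vec l (\<lambda>i. poly [:c:] (\<alpha> $ i)) | c. True}"
    unfolding RS_def by (auto simp del: poly_pCons) (metis degree_eq_zeroE)
  then show ?thesis by simp
qed

lemma lin_span_all_ones: "lin_span l {vec l (\<lambda>_. 1 :: 'a::field)} = {vec l (\<lambda>_. c) | c. True}"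
proof -
  interpret vec_space "TYPE('a)" l .
  let ?e = "vec l (\<lambda>_. 1 :: 'a)"
  have e: "{?e} \<subseteq> carrier_vec l" by simp
  have "lincomb a {?e} = vec l (\<lambda>_. a ?e)" for a
    using lincomb_index[OF _ e] lincomb_dim[OF _ e] by (intro eq_vecI) auto
  then have "span {?e} = {vec l (\<lambda>_. a ?e) | a. True}"
    using finite_span[OF _ e] by simp
  also have "\<dots> = {vec l (\<lambda>_. c) | c. True}" by (auto intro: exI[of _ "\<lambda>_. _"])
  finally show ?thesis unfolding lin_span_def by simp
qed

section \<open>Prefixes, blocks and candidates\<close>

lemma fixed_prefix_eq_iff:
  "fixed_prefix k r v = fixed_prefix k r w \<longleftrightarrow> (\<forall>i<r * (2 * k - 1). v $ i = w $ i)"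
  by (auto simp: fixed_prefix_def vec_first_def vec_eq_iff)

lemma fixed_prefix_Suc_eq_iff:
  "fixed_prefix k (Suc r) v = fixed_prefix k (Suc r) w \<longleftrightarrow>
     fixed_prefix k r v = fixed_prefix k r w \<and> block k r v = block k r w"
proof -
  let ?n = "2 * k - 1"
  have "(\<forall>i<Suc r * ?n. v $ i = w $ i) \<longleftrightarrow>
    (\<forall>i<r * ?n. v $ i = w $ i) \<and> (\<forall>i<?n. v $ (r * ?n + i) = w $ (r * ?n + i))" (is "?L \<longleftrightarrow> ?P \<and> ?B")
  proof (intro iffI allI impI)
    fix i assume PB: "?P \<and> ?B" and i: "i < Suc r * ?n"
    show "v $ i = w $ i"
    proof (cases "i < r * ?n")
      case False
      then have "i - r * ?n < ?n" "r * ?n + (i - r * ?n) = i" using i by auto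
      then show ?thesis using PB by metis
    qed (use PB in blast)
  qed auto
  then show ?thesis unfolding fixed_prefix_eq_iff by (simp add: block_def vec_eq_iff)
qed

lemma block_eq_if_fixed_prefix_eq:
  assumes "fixed_prefix k r v = fixed_prefix k r w" and "r' < r"
  shows "block k r' v = block k r' w"
  using assms by (induction r) (auto simp: fixed_prefix_Suc_eq_iff less_Suc_eq)

lemma inj_on_block:
  assumes "evaluation_vector l y" and "Suc r * (2 * k - 1) \<le> l"
  shows "inj_on (\<lambda>h. block k r y $ h) {..<2 * k - 1}"
proof (rule inj_onI)
  fix i j assume "i \<in> {..<2 * k - 1}" "j \<in> {..<2 * k - 1}" "block k r y $ i = block k r y $ j"
  moreover from this have "r * (2 * k - 1) + i < l" "r * (2 * k - 1) + j < l" using assms(2) by auto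
  ultimately have "r * (2 * k - 1) + i = r * (2 * k - 1) + j"
    by (intro inj_onD[OF evaluation_vector_inj_on[OF assms(1)]]) (auto simp: block_def)
  then show "i = j" by simp
qed

lemma candidatesD:
  assumes w: "w \<in> candidates k l r z A" and r: "Suc r * (2 * k - 1) \<le> l"
  shows "evaluation_vector l w"
    and "fixed_prefix k r w = fixed_prefix k r z"
    and "block k r w \<in> carrier_vec (2 * k - 1) - blocked k r z A"
proof -
  let ?n = "2 * k - 1"
  from w obtain u u' where uu: "w = fixed_prefix k r z @\<^sub>v u @\<^sub>v u'"
    "u \<in> carrier_vec ?n - blocked k r z A" "u' \<in> carrier_vec (l - Suc r * ?n)"
    "distinct (list_of_vec w)" unfolding candidates_def by blast
  have dims: "dim_vec (fixed_prefix k r z) = r * ?n" "dim_vec u = ?n" "dim_vec u' = l - Suc r * ?n"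
    using uu by (auto simp: fixed_prefix_def)
  have "dim_vec w = l" using dims r unfolding uu(1) by simp
  then show "evaluation_vector l w"
    using uu(4) unfolding evaluation_vector_def by (auto intro: carrier_vecI)
  show "fixed_prefix k r w = fixed_prefix k r z"
    unfolding fixed_prefix_eq_iff using dims uu(1) by (auto simp: fixed_prefix_def vec_first_def)
  have "(p @\<^sub>v u @\<^sub>v v) $ (dim_vec p + i) = u $ i" if "i < dim_vec u" for p v :: "'a vec" and i
    using that by simp
  from this[of _ "fixed_prefix k r z"] have "block k r w = u"
    by (intro eq_vecI) (simp_all only: dims block_def uu(1) dim_vec index_vec)
  then show "block k r w \<in> carrier_vec ?n - blocked k r z A" using uu(2) by simp
qed

lemma list_of_vec_fixed_prefix:
  assumes "evaluation_vector l z" and "r * (2 * k - 1) \<le> l"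
  shows "list_of_vec (fixed_prefix k r z) = take (r * (2 * k - 1)) (list_of_vec z)"
proof (rule nth_equalityI)
  have l: "dim_vec z = l" using assms(1) by (auto simp: evaluation_vector_def)
  show "length (list_of_vec (fixed_prefix k r z)) = length (take (r * (2 * k - 1)) (list_of_vec z))"
    using assms(2) l by (simp add: fixed_prefix_def)
  fix i assume "i < length (list_of_vec (fixed_prefix k r z))"
  then show "list_of_vec (fixed_prefix k r z) ! i = take (r * (2 * k - 1)) (list_of_vec z) ! i"
    by (simp add: fixed_prefix_def vec_first_def list_of_vec_index)
qed

text \<open>The vector \<open>u\<close> exists because some vector is not blocked, and it avoids the fixed prefix by the
  definition of blocked vectors. The tail is filled with unused field elements, of which there are
  enough since \<open>l \<le> CARD('a)\<close>.\<close>

lemma candidates_nonempty: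
  fixes z :: "'a::{field,finite} vec"
  assumes z: "evaluation_vector l z" and r: "Suc r * (2 * k - 1) \<le> l" and q: "l \<le> CARD('a)"
    and free: "blocked k r z A \<noteq> carrier_vec (2 * k - 1)"
  shows "candidates k l r z A \<noteq> {}"
proof -
  let ?n = "2 * k - 1"
  let ?p = "fixed_prefix k r z"
  have "blocked k r z A \<subseteq> carrier_vec ?n" unfolding blocked_def by auto
  with free obtain u where u: "u \<in> carrier_vec ?n" "u \<notin> blocked k r z A" by blast
  then have du: "distinct (list_of_vec u)" "set (list_of_vec u) \<inter> set (list_of_vec ?p) = {}"
    unfolding blocked_def by (auto simp: set_list_of_vec)
  let ?xs = "list_of_vec ?p @ list_of_vec u"
  have dp: "distinct (list_of_vec ?p)"
    using z r list_of_vec_fixed_prefix[OF z, of r k] by (simp add: evaluation_vector_def)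
  have len: "length ?xs = Suc r * ?n" using u(1) by (simp add: fixed_prefix_def)
  have dxs: "distinct ?xs" using dp du by auto
  have "card (set ?xs) = Suc r * ?n" using distinct_card[OF dxs] len by simp
  then have "l - Suc r * ?n \<le> CARD('a) - card (set ?xs)" using q by (simp only: diff_le_mono)
  then have "l - Suc r * ?n \<le> card (- set ?xs)" by (simp add: Compl_eq_Diff_UNIV card_Diff_subset del: set_append)
  then obtain S where S: "S \<subseteq> - set ?xs" "card S = l - Suc r * ?n" "finite S"
    by (metis obtain_subset_with_card_n)
  obtain ys where ys: "set ys = S" "distinct ys" using finite_distinct_list[OF S(3)] by blast
  have "length ys = l - Suc r * ?n" using ys S(2) distinct_card by metis
  then have "vec_of_list ys \<in> carrier_vec (l - Suc r * ?n)" by (intro carrier_vecI) simp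
  moreover have "distinct (list_of_vec (?p @\<^sub>v u @\<^sub>v vec_of_list ys))"
    using dxs ys S(1) by (auto simp: list_vec)
  ultimately have "?p @\<^sub>v u @\<^sub>v vec_of_list ys \<in> candidates k l r z A"
    using u unfolding candidates_def by blast
  then show ?thesis by blast
qed

section \<open>The inner loop\<close>

lemma bij_betw_list_of_vec: "bij_betw list_of_vec (carrier_vec n) {xs. length xs = n}"
proof (rule bij_betw_byWitness[where f' = vec_of_list])
  show "list_of_vec ` carrier_vec n \<subseteq> {xs. length xs = n}" by auto
  show "vec_of_list ` {xs. length xs = n} \<subseteq> carrier_vec n" by (auto intro: carrier_vecI)
qed (auto simp: vec_list list_vec)

lemma finite_carrier_vec: "finite (carrier_vec n :: 'a::finite vec set)"
  using finite_lists_length_eq[of "UNIV :: 'a set" n] bij_betw_finite[OF bij_betw_list_of_vec[of n, where 'a = 'a]]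
  by simp

text \<open>A loop can only stop when the blocked vectors fill the whole space. Each member of \<open>A\<close> blocks a
  proportion of at most \<open>(k choose 2) / q\<close>, a repeated coordinate accounts for
  \<open>(2 * k - 1 choose 2) / q\<close>, and a clash with the fixed prefix for \<open>(2 * k - 1)\<^sup>2 * r / q\<close>.
  The proportions must add up to at least \<open>1\<close>.\<close>

lemma card_le_if_all_blocked:
  fixes z :: "'a::{field,finite} vec"
  assumes k: "1 \<le> k" and A: "finite A"
    and inj: "\<And>y. y \<in> A \<Longrightarrow> inj_on (\<lambda>h. block k r y $ h) {..<2 * k - 1}"
    and all: "blocked k r z A = carrier_vec (2 * k - 1)"
  shows "CARD('a) \<le> ((2 * k - 1) choose 2) + (2 * k - 1)\<^sup>2 * r + card A * (k choose 2)"
proof -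
  let ?n = "2 * k - 1"
  let ?q = "CARD('a)"
  let ?D = "\<lambda>y. {xs. length xs = ?n \<and> vanishing_pair k (k - 1) (\<lambda>h. block k r y $ h) xs}"
  let ?E = "{xs :: 'a list. length xs = ?n \<and> \<not> distinct xs}"
  let ?S = "set\<^sub>v (fixed_prefix k r z)"
  let ?F = "{xs :: 'a list. length xs = ?n \<and> set xs \<inter> ?S \<noteq> {}}"
  have n: "k + (k - 1) = ?n" and n': "Suc (k - 1) = k" using k by auto
  have fin: "finite {xs :: 'a list. length xs = ?n}"
    using finite_lists_length_eq[of "UNIV :: 'a set" ?n] by simp
  have finD: "finite (?D y)" for y :: "'a vec" by (rule finite_subset[OF _ fin]) auto
  have finEF: "finite ?E" "finite ?F" by (rule finite_subset[OF _ fin]; auto)+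
  have D: "card (?D y) * ?q \<le> (k choose 2) * ?q ^ ?n" if "y \<in> A" for y
    using card_vanishing_pair[of "\<lambda>h. block k r y $ h" k "k - 1"] inj[OF that] unfolding n n' by simp
  have S: "card ?S \<le> r * ?n"
    using card_length[of "list_of_vec (fixed_prefix k r z)"]
    by (simp add: set_list_of_vec[symmetric] fixed_prefix_def)
  have "{xs :: 'a list. length xs = ?n} \<subseteq> (\<Union>y\<in>A. ?D y) \<union> ?E \<union> ?F"
  proof
    fix xs :: "'a list" assume "xs \<in> {xs. length xs = ?n}"
    then have len: "length xs = ?n" by simp
    then have v: "vec_of_list xs \<in> carrier_vec ?n" by (intro carrier_vecI) simp
    then have "vec_of_list xs \<in> blocked k r z A" using all by simp
    then show "xs \<in> (\<Union>y\<in>A. ?D y) \<union> ?E \<union> ?F"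
      using det_V_mat_eq_0_iff[OF k v] len unfolding blocked_def
      by (auto simp: list_vec set_list_of_vec[symmetric])
  qed
  then have "?q ^ ?n \<le> card ((\<Union>y\<in>A. ?D y) \<union> ?E \<union> ?F)"
    using A finD finEF card_lists_length_eq[of "UNIV :: 'a set" ?n]
      card_mono[of "(\<Union>y\<in>A. ?D y) \<union> ?E \<union> ?F" "{xs :: 'a list. length xs = ?n}"] by simp
  also have "\<dots> \<le> (\<Sum>y\<in>A. card (?D y)) + card ?E + card ?F"
    using card_Un_le[of "(\<Union>y\<in>A. ?D y) \<union> ?E" ?F] card_Un_le[of "(\<Union>y\<in>A. ?D y)" ?E]
      card_UN_le[OF A, of ?D] by linarith
  finally have "?q ^ ?n * ?q \<le> ((\<Sum>y\<in>A. card (?D y)) + card ?E + card ?F) * ?q"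
    by (rule mult_right_mono) simp
  also have "\<dots> = (\<Sum>y\<in>A. card (?D y) * ?q) + card ?E * ?q + card ?F * ?q"
    by (simp only: add_mult_distrib sum_distrib_right)
  also have "\<dots> \<le> (\<Sum>y\<in>A. (k choose 2) * ?q ^ ?n) + (?n choose 2) * ?q ^ ?n + ?n * (r * ?n) * ?q ^ ?n"
  proof (intro add_mono sum_mono)
    show "card ?E * ?q \<le> (?n choose 2) * ?q ^ ?n" by (rule card_not_distinct_lists)
    have "card ?F * ?q \<le> ?n * card ?S * ?q ^ ?n" by (rule card_lists_meeting)
    also have "\<dots> \<le> ?n * (r * ?n) * ?q ^ ?n" by (intro mult_right_mono mult_left_mono S) auto
    finally show "card ?F * ?q \<le> ?n * (r * ?n) * ?q ^ ?n" .
  qed (rule D)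
  also have "\<dots> = ((?n choose 2) + ?n\<^sup>2 * r + card A * (k choose 2)) * ?q ^ ?n"
  proof -
    have "a * (c * Q) + b * Q + m * (r * m) * Q = (b + m\<^sup>2 * r + a * c) * Q" for a b c m Q :: nat
      by (simp add: algebra_simps power2_eq_square)
    then show ?thesis by (simp only: sum_constant of_nat_id)
  qed
  finally have "?q * ?q ^ ?n \<le> ((?n choose 2) + ?n\<^sup>2 * r + card A * (k choose 2)) * ?q ^ ?n"
    by (simp only: mult.commute)
  then show ?thesis unfolding mult_le_cancel2 by simp
qed

text \<open>The invariant of the loop that extends \<open>z\<close> by its block number \<open>r\<close>.\<close>

definition extension_family :: "nat \<Rightarrow> nat \<Rightarrow> nat \<Rightarrow> 'a::field vec \<Rightarrow> 'a vec set \<Rightarrow> bool" where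
  "extension_family k l r z A \<longleftrightarrow> z \<in> A \<and>
     (\<forall>y\<in>A. evaluation_vector l y \<and> fixed_prefix k r y = fixed_prefix k r z) \<and>
     (\<forall>x\<in>A. \<forall>y\<in>A. x \<noteq> y \<longrightarrow> agree_only_in_constants k (block k r x) (block k r y))"

lemma extension_family_insert:
  assumes k: "2 \<le> k" and r: "Suc r * (2 * k - 1) \<le> l"
    and A: "extension_family k l r z A" and w: "w \<in> candidates k l r z A"
  shows "extension_family k l r z (insert w A)" and "w \<notin> A"
proof -
  note wD = candidatesD[OF w r]
  have agree: "agree_only_in_constants k (block k r y) (block k r w)" if "y \<in> A" for y
    using wD(3) that k unfolding blocked_def by (intro agree_only_in_constants_if_det) auto
  show "w \<notin> A" using agree not_agree_only_in_constants_self[OF k] by blast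
  have "agree_only_in_constants k (block k r x) (block k r y)"
    if "x \<in> insert w A" "y \<in> insert w A" "x \<noteq> y" for x y
    using that A agree agree_only_in_constants_sym unfolding extension_family_def by blast
  then show "extension_family k l r z (insert w A)"
    using A wD(1,2) unfolding extension_family_def by blast
qed

text \<open>Every round adds a new evaluation vector, so the loop ends because there are only finitely many of
  them; the bound on the size of the result is the stopping condition.\<close>

lemma extend_loop_result:
  fixes z :: "'a::{field,finite} vec"
  assumes k: "2 \<le> k" and r: "Suc r * (2 * k - 1) \<le> l" and q: "l \<le> CARD('a)"
    and z: "evaluation_vector l z" and pick: "valid_selector k l pick"
  obtains A where "extend_loop pick k r z = Some A" and "extension_family k l r z A"
    and "CARD('a) \<le> ((2 * k - 1) choose 2) + (2 * k - 1)\<^sup>2 * r + card A * (k choose 2)"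
proof -
  let ?C = "carrier_vec l :: 'a vec set"
  let ?b = "\<lambda>A. blocked k r z A \<noteq> carrier_vec (2 * k - 1)"
  have sub: "A \<subseteq> ?C" if "extension_family k l r z A" for A
    using that unfolding extension_family_def evaluation_vector_def by auto
  have step: "extension_family k l r z (insert (pick r z A) A) \<and> pick r z A \<notin> A"
    if A: "extension_family k l r z A" and b: "?b A" for A
  proof -
    have "pick r z A \<in> candidates k l r z A"
      using candidates_nonempty[OF z r q b] pick unfolding valid_selector_def by blast
    then show ?thesis using extension_family_insert[OF k r A] by blast
  qed
  have init: "extension_family k l r z {z}" using z unfolding extension_family_def by simp
  have "\<exists>A. while_option ?b (\<lambda>A. insert (pick r z A) A) {z} = Some A"
  proof (rule measure_while_option_Some[where P = "extension_family k l r z" and f = "\<lambda>A. card (?C - A)"])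
    fix A assume A: "extension_family k l r z A" and b: "?b A"
    note s = step[OF A b]
    then have "pick r z A \<in> ?C - A" using sub[of "insert (pick r z A) A"] by blast
    then have "card (?C - insert (pick r z A) A) < card (?C - A)"
      by (intro psubset_card_mono finite_Diff finite_carrier_vec) auto
    then show "extension_family k l r z (insert (pick r z A) A) \<and>
        card (?C - insert (pick r z A) A) < card (?C - A)" using s by blast
  qed (rule init)
  then obtain A where A: "while_option ?b (\<lambda>A. insert (pick r z A) A) {z} = Some A" by blast
  have fam: "extension_family k l r z A"
    by (rule while_option_rule[where P = "extension_family k l r z", OF _ A init]) (use step in blast)
  have "blocked k r z A = carrier_vec (2 * k - 1)" using while_option_stop[OF A] by simp
  then have "CARD('a) \<le> ((2 * k - 1) choose 2) + (2 * k - 1)\<^sup>2 * r + card A * (k choose 2)"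
    using k fam finite_subset[OF sub[OF fam] finite_carrier_vec]
    by (intro card_le_if_all_blocked inj_on_block[OF _ r]) (auto simp: extension_family_def)
  then show thesis using that A fam unfolding extend_loop_def by blast
qed

section \<open>The stages\<close>

text \<open>The number \<open>b\<close> is any lower bound for what each single loop contributes. Two members of a stage
  are separated by some block: by the newest one if they extend the same vector, and otherwise by
  the block that separated the vectors which they extend, since that block was copied. Families that
  extend different vectors are thus disjoint, and the sizes multiply.\<close>

lemma stages_result:
  fixes z :: "'a::{field,finite} vec" and b :: real
  assumes k: "2 \<le> k" and q: "l \<le> CARD('a)" and z: "evaluation_vector l z"
    and pick: "valid_selector k l pick" and s: "s * (2 * k - 1) \<le> l" and b: "0 \<le> b"
    and b_le: "\<forall>r<s. \<forall>N.
      CARD('a) \<le> ((2 * k - 1) choose 2) + (2 * k - 1)\<^sup>2 * r + N * (k choose 2) \<longrightarrow> b \<le> real N"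
  shows "\<exists>A. stages pick k z s = Some A \<and> finite A \<and> (\<forall>\<alpha>\<in>A. evaluation_vector l \<alpha>) \<and>
     (\<forall>\<alpha>\<in>A. \<forall>\<alpha>'\<in>A. \<alpha> \<noteq> \<alpha>' \<longrightarrow> (\<exists>r<s. agree_only_in_constants k (block k r \<alpha>) (block k r \<alpha>'))) \<and>
     b ^ s \<le> real (card A)"
  using s b_le
proof (induction s)
  case 0
  then show ?case using z by simp
next
  case (Suc s)
  have "s * (2 * k - 1) \<le> l" using Suc.prems(1) by simp
  moreover have "\<forall>r<s. \<forall>N.
      CARD('a) \<le> ((2 * k - 1) choose 2) + (2 * k - 1)\<^sup>2 * r + N * (k choose 2) \<longrightarrow> b \<le> real N"
    using Suc.prems(2) less_SucI by blast
  ultimately obtain A where A: "stages pick k z s = Some A" "finite A"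
    "\<And>\<alpha>. \<alpha> \<in> A \<Longrightarrow> evaluation_vector l \<alpha>"
    "\<And>\<alpha> \<alpha>'. \<alpha> \<in> A \<Longrightarrow> \<alpha>' \<in> A \<Longrightarrow> \<alpha> \<noteq> \<alpha>' \<Longrightarrow>
       \<exists>r<s. agree_only_in_constants k (block k r \<alpha>) (block k r \<alpha>')"
    "b ^ s \<le> real (card A)" using Suc.IH by blast
  let ?X = "\<lambda>y. the (extend_loop pick k s y)"
  have X: "extend_loop pick k s y = Some (?X y) \<and> extension_family k l s y (?X y) \<and> b \<le> real (card (?X y))"
    if y: "y \<in> A" for y
  proof -
    obtain B where "extend_loop pick k s y = Some B" "extension_family k l s y B"
      "CARD('a) \<le> ((2 * k - 1) choose 2) + (2 * k - 1)\<^sup>2 * s + card B * (k choose 2)"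
      by (rule extend_loop_result[OF k Suc.prems(1) q A(3)[OF y] pick])
    then show ?thesis using Suc.prems(2)[rule_format, of s "card B"] by simp
  qed
  have ev: "evaluation_vector l \<alpha>" if "y \<in> A" "\<alpha> \<in> ?X y" for y \<alpha>
    using X[OF that(1)] that(2) unfolding extension_family_def by blast
  have finX: "finite (?X y)" if "y \<in> A" for y
    by (rule finite_subset[OF _ finite_carrier_vec[of l]])
      (use ev[OF that] in \<open>auto simp: evaluation_vector_def\<close>)
  have across: "\<exists>r<s. agree_only_in_constants k (block k r \<alpha>) (block k r \<alpha>')"
    if "y \<in> A" "y' \<in> A" "y \<noteq> y'" "\<alpha> \<in> ?X y" "\<alpha>' \<in> ?X y'" for y y' \<alpha> \<alpha>'
  proof -
    have p: "fixed_prefix k s \<alpha> = fixed_prefix k s y" "fixed_prefix k s \<alpha>' = fixed_prefix k s y'"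
      using X[OF that(1)] X[OF that(2)] that(4,5) unfolding extension_family_def by blast+
    from A(4)[OF that(1-3)] obtain r where
      "r < s" "agree_only_in_constants k (block k r y) (block k r y')" by blast
    then show ?thesis
      using block_eq_if_fixed_prefix_eq[OF p(1)] block_eq_if_fixed_prefix_eq[OF p(2)] by auto
  qed
  let ?A = "\<Union>y\<in>A. ?X y"
  have stage: "stages pick k z (Suc s) = Some ?A"
    using A(1) X by (simp del: not_None_eq) (metis option.distinct(1))
  have sep: "\<exists>r<Suc s. agree_only_in_constants k (block k r \<alpha>) (block k r \<alpha>')"
    if mem: "\<alpha> \<in> ?A" "\<alpha>' \<in> ?A" and ne: "\<alpha> \<noteq> \<alpha>'" for \<alpha> \<alpha>'
  proof -
    from mem obtain y y' where y: "y \<in> A" "y' \<in> A" "\<alpha> \<in> ?X y" "\<alpha>' \<in> ?X y'" by blast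
    show ?thesis
    proof (cases "y = y'")
      case True
      then have "agree_only_in_constants k (block k s \<alpha>) (block k s \<alpha>')"
        using X[OF y(1)] y ne unfolding extension_family_def by blast
      then show ?thesis by blast
    next
      case False
      then show ?thesis using across[OF y(1,2) _ y(3,4)] less_SucI by blast
    qed
  qed
  have disj: "?X y \<inter> ?X y' = {}" if "y \<in> A" "y' \<in> A" "y \<noteq> y'" for y y'
    using across[OF that] not_agree_only_in_constants_self[OF k] by blast
  have "b ^ Suc s \<le> real (card A) * b" using A(5) b by (simp add: mult.commute mult_left_mono)
  also have "\<dots> \<le> (\<Sum>y\<in>A. real (card (?X y)))" using X by (intro sum_bounded_below) auto
  also have "\<dots> = real (card ?A)"
    using card_UN_disjoint[of A ?X] A(2) finX disj by simp
  finally show ?case using stage A(2) finX ev sep by auto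
qed

section \<open>The sunflower\<close>

lemma petal_bound_bigomega:
  assumes k: "2 \<le> k"
  shows "petal_bound k l \<in> \<Omega>(\<lambda>q. real q ^ (l div (2 * k - 1)))"
proof -
  define c where "c = real ((2 * k - 1) choose 2) + real ((2 * k - 1)^2) * (real (l div (2 * k - 1)) - 1)"
  define d where "d = real (k choose 2)"
  have "0 < k choose 2" using k by (simp add: zero_less_binomial)
  then have d: "0 < d" by (simp add: d_def)
  have "(\<lambda>q. (real q - c) / d) \<in> \<Omega>(\<lambda>q. real q)"
  proof (rule landau_omega.bigI[where c = "1 / (2 * d)"])
    show "\<forall>\<^sub>F q in sequentially. norm ((real q - c) / d) \<ge> 1 / (2 * d) * norm (real q)"
      using eventually_ge_at_top[of "nat \<lceil>2 * \<bar>c\<bar>\<rceil>"]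
    proof eventually_elim
      case (elim q)
      then have "2 * \<bar>c\<bar> \<le> real q" by linarith
      then have "real q / 2 \<le> \<bar>real q - c\<bar>" by linarith
      then show ?case using d by (simp add: field_simps)
    qed
  qed (use d in simp)
  then have "(\<lambda>q. ((real q - c) / d) ^ (l div (2 * k - 1))) \<in> \<Omega>(\<lambda>q. real q ^ (l div (2 * k - 1)))"
    by (rule landau_omega.big_power)
  then show ?thesis
    by (simp add: petal_bound_def[abs_def] Let_def c_def d_def algebra_simps)
qed

theorem theorem3p14:
  fixes k l :: nat
    and z :: "'a::{field,finite} vec"
    and pick :: "nat \<Rightarrow> 'a vec \<Rightarrow> 'a vec set \<Rightarrow> 'a vec"
  assumes "k \<ge> 2" and "l \<ge> 2 * k - 1"
    and "CARD('a) > ((2 * k - 1) choose 2) + (2 * k - 1) * l"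
    and "evaluation_vector l z"
    and "valid_selector k l pick"
  shows "(\<exists>A. algorithm1 pick k l z = Some A \<and>
            (\<forall>\<alpha>\<in>A. evaluation_vector l \<alpha>) \<and>
            (\<forall>\<alpha>\<in>A. \<forall>\<alpha>'\<in>A. \<alpha> \<noteq> \<alpha>' \<longrightarrow>
               RS l k \<alpha> \<inter> RS l k \<alpha>' = lin_span l {vec l (\<lambda>_. 1)}) \<and>
            real (card A) \<ge> petal_bound k l CARD('a) \<and>
            RS_sunflower l k 1 (RS l k ` A) \<and>
            real (card (RS l k ` A)) \<ge> petal_bound k l CARD('a)) \<and>
         petal_bound k l \<in> \<Omega>(\<lambda>q. real q ^ (l div (2 * k - 1)))"
proof
  let ?n = "2 * k - 1"
  let ?q = "CARD('a)"
  define t where "t = l div ?n"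
  define b where "b = (real ?q - real (?n choose 2) - real (?n\<^sup>2) * (real t - 1)) / real (k choose 2)"
  let ?E = "lin_span l {vec l (\<lambda>_. 1 :: 'a)}"
  have n: "1 \<le> ?n" "k \<le> ?n" using assms(1) by auto
  have kl: "k \<le> l" using n assms(2) by linarith
  have "l \<le> ?n * l" using n(1) by simp
  then have ql: "l \<le> ?q" using assms(3) by linarith
  have tl: "t * ?n \<le> l" unfolding t_def by (rule div_times_less_eq_dividend)
  have c2: "0 < real (k choose 2)" using assms(1) by (simp add: zero_less_binomial)
  have "?n\<^sup>2 * t \<le> ?n * l" using tl by (simp add: power2_eq_square mult.assoc mult.commute)
  then have "(?n choose 2) + ?n\<^sup>2 * t \<le> ?q" using assms(3) by linarith
  from of_nat_mono[OF this, where 'a = real]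
  have "real (?n choose 2) + real (?n\<^sup>2) * real t \<le> real ?q"
    by (simp only: of_nat_add of_nat_mult)
  moreover have "0 \<le> real (?n\<^sup>2)" by (rule of_nat_0_le_iff)
  ultimately have "0 \<le> real ?q - real (?n choose 2) - real (?n\<^sup>2) * (real t - 1)"
    unfolding right_diff_distrib by linarith
  then have b0: "0 \<le> b" using c2 unfolding b_def by (intro divide_nonneg_pos)
  \<comment> \<open>the last stage, \<open>r = t - 1\<close>, has the longest prefix and hence the weakest bound; \<open>b\<close> is that bound\<close>
  have b_le: "\<forall>r<t. \<forall>N. ?q \<le> (?n choose 2) + ?n\<^sup>2 * r + N * (k choose 2) \<longrightarrow> b \<le> real N"
  proof (intro allI impI)
    fix r N assume r: "r < t" and N: "?q \<le> (?n choose 2) + ?n\<^sup>2 * r + N * (k choose 2)"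
    have "real ?q \<le> real (?n choose 2) + real (?n\<^sup>2) * real r + real N * real (k choose 2)"
      using of_nat_mono[OF N, where 'a = real] by (simp only: of_nat_add of_nat_mult)
    moreover have "real (?n\<^sup>2) * real r \<le> real (?n\<^sup>2) * (real t - 1)"
      using r by (intro mult_left_mono) auto
    ultimately have "real ?q - real (?n choose 2) - real (?n\<^sup>2) * (real t - 1) \<le> real N * real (k choose 2)"
      by linarith
    then show "b \<le> real N" using c2 unfolding b_def by (simp only: pos_divide_le_eq)
  qed
  have bound: "petal_bound k l ?q = b ^ t" unfolding petal_bound_def b_def t_def Let_def ..
  obtain A where A: "algorithm1 pick k l z = Some A" "finite A"
    "\<And>\<alpha>. \<alpha> \<in> A \<Longrightarrow> evaluation_vector l \<alpha>"
    "\<And>\<alpha> \<alpha>'. \<alpha> \<in> A \<Longrightarrow> \<alpha>' \<in> A \<Longrightarrow> \<alpha> \<noteq> \<alpha>' \<Longrightarrow>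
       \<exists>r<t. agree_only_in_constants k (block k r \<alpha>) (block k r \<alpha>')"
    "b ^ t \<le> real (card A)"
    using stages_result[OF assms(1) ql assms(4,5) tl b0 b_le] unfolding algorithm1_def t_def[symmetric]
    by blast
  have inter: "RS l k \<alpha> \<inter> RS l k \<alpha>' = ?E" if mem: "\<alpha> \<in> A" "\<alpha>' \<in> A" "\<alpha> \<noteq> \<alpha>'" for \<alpha> \<alpha>'
  proof -
    from A(4)[OF mem] obtain r where r: "r < t" "agree_only_in_constants k (block k r \<alpha>) (block k r \<alpha>')"
      by blast
    have "Suc r * ?n \<le> t * ?n" using r(1) by (intro mult_le_mono1) simp
    then have "Suc r * ?n \<le> l" using tl by linarith
    then show ?thesis using RS_inter[OF r(2)] assms(1) by (simp add: lin_span_all_ones)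
  qed
  have E: "?E = RS l 1 z" unfolding lin_span_all_ones RS_dimension_one ..
  have dimE: "is_subspace l ?E" "subspace_dim l ?E = 1"
    unfolding E using RS_subspace_dim[OF assms(4), of 1] kl assms(1) by auto
  have dimRS: "is_subspace l (RS l k \<alpha>)" "subspace_dim l (RS l k \<alpha>) = k" if "\<alpha> \<in> A" for \<alpha>
    using RS_subspace_dim[OF A(3)[OF that], of k] kl assms(1) by auto
  \<comment> \<open>two equal petals would equal the center, whose dimension is \<open>1 < k\<close>\<close>
  have "inj_on (RS l k) A"
  proof (rule inj_onI, rule ccontr)
    fix \<alpha> \<alpha>' assume "\<alpha> \<in> A" "\<alpha>' \<in> A" "RS l k \<alpha> = RS l k \<alpha>'" "\<alpha> \<noteq> \<alpha>'"
    then have "RS l k \<alpha> = ?E" using inter[of \<alpha> \<alpha>'] by simp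
    then show False using dimRS(2)[OF \<open>\<alpha> \<in> A\<close>] dimE(2) assms(1) by simp
  qed
  then have card: "card (RS l k ` A) = card A" by (rule card_image)
  have "RS_sunflower l k 1 (RS l k ` A)"
    unfolding RS_sunflower_def
  proof (intro conjI)
    show "\<forall>C\<in>RS l k ` A. is_subspace l C \<and> subspace_dim l C = k \<and>
        (\<exists>\<alpha>. evaluation_vector l \<alpha> \<and> C = RS l k \<alpha>)"
      using dimRS A(3) by blast
    show "\<exists>E. is_subspace l E \<and> subspace_dim l E = 1 \<and>
        (\<forall>C\<in>RS l k ` A. \<forall>D\<in>RS l k ` A. C \<noteq> D \<longrightarrow> C \<inter> D = E)"
    proof (intro exI[of _ ?E] conjI ballI impI)
      fix C D assume "C \<in> RS l k ` A" "D \<in> RS l k ` A" "C \<noteq> D"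
      then show "C \<inter> D = ?E" using inter by auto
    qed (fact dimE)+
  qed (use assms(1) kl ql in auto)
  then show "\<exists>A. algorithm1 pick k l z = Some A \<and>
            (\<forall>\<alpha>\<in>A. evaluation_vector l \<alpha>) \<and>
            (\<forall>\<alpha>\<in>A. \<forall>\<alpha>'\<in>A. \<alpha> \<noteq> \<alpha>' \<longrightarrow>
               RS l k \<alpha> \<inter> RS l k \<alpha>' = lin_span l {vec l (\<lambda>_. 1)}) \<and>
            real (card A) \<ge> petal_bound k l CARD('a) \<and>
            RS_sunflower l k 1 (RS l k ` A) \<and>
            real (card (RS l k ` A)) \<ge> petal_bound k l CARD('a)"
    using A(1,3,5) inter card bound by (intro exI[of _ A]) simp
qed (rule petal_bound_bigomega[OF assms(1)])

end
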